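(* Let $n\ge1$ and let $e,f\ge0$ be integers with $e+f=n+1$. When evaluated in $n\times n$ matrices, the two expressions $$CH_{e,f}=\sum_{\sigma\in S_{n+1}}\epsilon_\sigma\Psi_\sigma,\qquad T_{e,f}=\sum_{\sigma\in S_{n+1}}\epsilon_\sigma\Phi_\sigma$$ vanish. That is, for every supercommutative superalgebra $A$ and every substitution of the variables $y_i$ by degree $0$ elements of $M_n(A)$ and of the variables $x_j$ by degree $1$ elements of $M_n(A)$, with $t$ interpreted as the usual matrix trace, both expressions become $0$.
   Context: All algebras are over $\mathbb C$. A superalgebra is a $\mathbb Z/2$-graded associative algebra; $A$ is supercommutative if $ab=(-1)^{d(a)d(b)}ba$ for homogeneous $a,b$ of degrees $d(a),d(b)\in\{0,1\}$. $M_n(A)=M_n(\mathbb C)\otimes A$ is $\mathbb Z/2$-graded with $M_n(\mathbb C)$ in degree $0$. A superalgebra with trace is a superalgebra $R$ with a linear degree-preserving map $t:R\to R$ such that for homogeneous $a,b$: $t(a)b=(-1)^{d(a)d(b)}b\,t(a)$, $t(ab)=(-1)^{d(a)d(b)}t(ba)$, $t(t(a)b)=t(a)t(b)$. $\mathcal F_T$ denotes the free superalgebra with trace on degree $1$ (fermionic) variables $x_1,x_2,\dots$ and degree $0$ (bosonic) variables $y_1,y_2,\dots$. $M_n(A)$ with $A$ supercommutative is a superalgebra with trace for the usual trace. Let $m=n+1=e+f$. Put $z_i=y_i$ for $1\le i\le e$ and $z_{e+j}=x_j$ for $1\le j\le f$; indices $>e$ are called fermionic. Let $\sigma\in S_m$,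 written in cycle form $(w_1)(w_2)\cdots(w_r)$, each $w_k$ a word in the indices (a cycle $(i_1,i_2,\dots)$ means $i_1\mapsto i_2\mapsto\cdots$), including fixed points. For a word $w=i_1\cdots i_s$ write $z_w=z_{i_1}\cdots z_{i_s}$ (and $z_\emptyset=1$). Let $\epsilon(w_1\cdots w_r)$ be the sign of the permutation that sorts into increasing order the subsequence of fermionic indices of the concatenated word $w_1w_2\cdots w_r$. Then $$\Phi_\sigma=\epsilon(w_1\cdots w_r)\,t(z_{w_1})\cdots t(z_{w_r}).$$ If the cycle form is chosen so that the last cycle is $w_r=u\,m$, ending with the index $m$, then $$\Psi_\sigma=\epsilon(w_1\cdots w_{r-1}u)\,t(z_{w_1})\cdots t(z_{w_{r-1}})\,z_u .$$ Both are independent of the choice of such display. $\epsilon_\sigma$ is the sign of $\sigma$. Thus $T_{e,f}$ involves $y_1,\dots,y_e,x_1,\dots,x_f$ and, for $f\geq1$, $CH_{e,f}$ involves $y_1,\dots,y_e,x_1,\dots,x_{f-1}$ (for $f=0$ it involves $y_1,\dots,y_n$). *)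

theory Defs
  imports "HOL-Analysis.Analysis" "HOL-Combinatorics.Combinatorics" "HOL-Library.Z2"
begin

section \<open>Superalgebras and superalgebras with trace\<close>

text \<open>
  The multiplication and the unit are explicit parameters because matrices over a
  ring are not an instance of the ring classes with respect to \<^const>\<open>matrix_matrix_mult\<close>
  (the class operation \<^const>\<open>times\<close> on vectors is componentwise).
\<close>

locale superalgebra = vector_space smul
  for smul :: "complex \<Rightarrow> 'r::ab_group_add \<Rightarrow> 'r" +
  fixes mul :: "'r \<Rightarrow> 'r \<Rightarrow> 'r" and one :: 'r and grade :: "bit \<Rightarrow> 'r set"
  assumes mul_assoc: "mul (mul a b) c = mul a (mul b c)"
    and mul_one_left: "mul one a = a"
    and mul_one_right: "mul a one = a"
    and mul_add_left: "mul (a + b) c = mul a c + mul b c"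
    and mul_add_right: "mul a (b + c) = mul a b + mul a c"
    and mul_scale_left: "mul (smul k a) b = smul k (mul a b)"
    and mul_scale_right: "mul a (smul k b) = smul k (mul a b)"
    and grade_subspace: "subspace (grade i)"
    and grade_disjoint: "grade 0 \<inter> grade 1 = {0}"
    and grade_decomp: "\<exists>b\<in>grade 0. \<exists>c\<in>grade 1. a = b + c"
    and grade_mul: "a \<in> grade i \<Longrightarrow> b \<in> grade j \<Longrightarrow> mul a b \<in> grade (i + j)"

definition koszul_sign :: "bit \<Rightarrow> bit \<Rightarrow> complex"
  where "koszul_sign i j = (if i = 1 \<and> j = 1 then -1 else 1)"

locale supercommutative_superalgebra = superalgebra +
  assumes supercomm: "a \<in> grade i \<Longrightarrow> b \<in> grade j \<Longrightarrow>
    mul a b = smul (koszul_sign i j) (mul b a)"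

locale superalgebra_with_trace = superalgebra smul mul one grade
  for smul :: "complex \<Rightarrow> 'r::ab_group_add \<Rightarrow> 'r" and mul one grade +
  fixes tr :: "'r \<Rightarrow> 'r"
  assumes tr_linear: "Vector_Spaces.linear smul smul tr"
    and tr_grade: "a \<in> grade i \<Longrightarrow> tr a \<in> grade i"
    and tr_supercentral: "a \<in> grade i \<Longrightarrow> b \<in> grade j \<Longrightarrow>
      mul (tr a) b = smul (koszul_sign i j) (mul b (tr a))"
    and tr_supercyclic: "a \<in> grade i \<Longrightarrow> b \<in> grade j \<Longrightarrow>
      tr (mul a b) = smul (koszul_sign i j) (tr (mul b a))"
    and tr_tr: "a \<in> grade i \<Longrightarrow> b \<in> grade j \<Longrightarrow>
      tr (mul (tr a) b) = mul (tr a) (tr b)"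


section \<open>Matrices over a supercommutative superalgebra\<close>

definition matrix_scale :: "(complex \<Rightarrow> 'a \<Rightarrow> 'a) \<Rightarrow> complex \<Rightarrow> 'a^'n^'n \<Rightarrow> 'a^'n^'n"
  where "matrix_scale smul k M = (\<chi> p q. smul k (M $ p $ q))"

definition matrix_grade :: "(bit \<Rightarrow> 'a set) \<Rightarrow> bit \<Rightarrow> ('a^'n^'n) set"
  where "matrix_grade grade i = {M. \<forall>p q. M $ p $ q \<in> grade i}"

text \<open>The trace has to be an endomap of the matrix algebra, so its value is a scalar matrix.\<close>

definition matrix_tr :: "'a::semiring_1^'n^'n \<Rightarrow> 'a^'n^'n"
  where "matrix_tr M = mat (trace M)"


section \<open>Cycle forms and signs\<close>

text \<open>Words are lists of indices; a word \<open>w\<close> is a cycle of \<open>\<sigma>\<close> iff \<open>\<sigma>\<close> maps each letter to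
  the cyclically next one. Fixed points are included as words of length one.\<close>

definition is_cycle_form :: "nat \<Rightarrow> (nat \<Rightarrow> nat) \<Rightarrow> nat list list \<Rightarrow> bool"
  where "is_cycle_form m \<sigma> ws \<longleftrightarrow>
    [] \<notin> set ws \<and> distinct (concat ws) \<and> set (concat ws) = {1..m} \<and>
    (\<forall>w\<in>set ws. map \<sigma> w = rotate1 w)"

definition cycle_form :: "nat \<Rightarrow> (nat \<Rightarrow> nat) \<Rightarrow> nat list list"
  where "cycle_form m \<sigma> = (SOME ws. is_cycle_form m \<sigma> ws)"

definition cycle_form_last :: "nat \<Rightarrow> (nat \<Rightarrow> nat) \<Rightarrow> nat list list"
  where "cycle_form_last m \<sigma> = (SOME ws. is_cycle_form m \<sigma> ws \<and> last (last ws) = m)"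

definition sorting_perm :: "nat list \<Rightarrow> nat \<Rightarrow> nat"
  where "sorting_perm xs = (THE p. p permutes {..<length xs} \<and> sorted (permute_list p xs))"

definition fermionic_sign :: "nat \<Rightarrow> nat list \<Rightarrow> int"
  where "fermionic_sign e w = sign (sorting_perm (filter (\<lambda>i. e < i) w))"


section \<open>The expressions, evaluated in an algebra with trace\<close>

text \<open>\<open>y i\<close> and \<open>x j\<close> (for \<open>i, j \<ge> 1\<close>) are the values substituted for the bosonic and
  fermionic variables.\<close>

definition var :: "nat \<Rightarrow> (nat \<Rightarrow> 'r) \<Rightarrow> (nat \<Rightarrow> 'r) \<Rightarrow> nat \<Rightarrow> 'r"
  where "var e y x i = (if i \<le> e then y i else x (i - e))"

locale trace_operations =
  fixes smul :: "complex \<Rightarrow> 'r::ab_group_add \<Rightarrow> 'r"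
    and mul :: "'r \<Rightarrow> 'r \<Rightarrow> 'r" and one :: 'r and tr :: "'r \<Rightarrow> 'r"
begin

definition list_prod :: "'r list \<Rightarrow> 'r"
  where "list_prod rs = foldr mul rs one"

definition word :: "(nat \<Rightarrow> 'r) \<Rightarrow> nat list \<Rightarrow> 'r"
  where "word z w = list_prod (map z w)"

definition Phi :: "nat \<Rightarrow> nat \<Rightarrow> (nat \<Rightarrow> 'r) \<Rightarrow> (nat \<Rightarrow> 'r) \<Rightarrow> (nat \<Rightarrow> nat) \<Rightarrow> 'r"
  where "Phi e f y x \<sigma> =
    (let z = var e y x; ws = cycle_form (e + f) \<sigma>
     in smul (of_int (fermionic_sign e (concat ws)))
          (list_prod (map (\<lambda>w. tr (word z w)) ws)))"

definition Psi :: "nat \<Rightarrow> nat \<Rightarrow> (nat \<Rightarrow> 'r) \<Rightarrow> (nat \<Rightarrow> 'r) \<Rightarrow> (nat \<Rightarrow> nat) \<Rightarrow> 'r"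
  where "Psi e f y x \<sigma> =
    (let z = var e y x; ws = cycle_form_last (e + f) \<sigma>;
         vs = butlast ws; u = butlast (last ws)
     in smul (of_int (fermionic_sign e (concat vs @ u)))
          (mul (list_prod (map (\<lambda>w. tr (word z w)) vs)) (word z u)))"

definition T :: "nat \<Rightarrow> nat \<Rightarrow> (nat \<Rightarrow> 'r) \<Rightarrow> (nat \<Rightarrow> 'r) \<Rightarrow> 'r"
  where "T e f y x =
    (\<Sum>\<sigma> | \<sigma> permutes {1..e + f}. smul (of_int (sign \<sigma>)) (Phi e f y x \<sigma>))"

definition CH :: "nat \<Rightarrow> nat \<Rightarrow> (nat \<Rightarrow> 'r) \<Rightarrow> (nat \<Rightarrow> 'r) \<Rightarrow> 'r"
  where "CH e f y x =
    (\<Sum>\<sigma> | \<sigma> permutes {1..e + f}. smul (of_int (sign \<sigma>)) (Psi e f y x \<sigma>))"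

end


section \<open>Well-definedness\<close>

lemma support_is_cycle:
  assumes "permutation \<sigma>"
  shows "map \<sigma> (support \<sigma> a) = rotate1 (support \<sigma> a)"
proof -
  have "map (cycle_of_list (support \<sigma> a)) (support \<sigma> a) = rotate1 (support \<sigma> a)"
    using cyclic_rotation[OF cycle_of_permutation[OF assms], of 1 a] by simp
  moreover have "map (cycle_of_list (support \<sigma> a)) (support \<sigma> a) = map \<sigma> (support \<sigma> a)"
    using cycle_restrict[OF assms] by (intro map_cong refl) metis
  ultimately show ?thesis by simp
qed

lemma funpow_stable: "(\<And>a. a \<in> S \<Longrightarrow> \<sigma> a \<in> S) \<Longrightarrow> a \<in> S \<Longrightarrow> (\<sigma> ^^ k) a \<in> S"
  by (induction k) auto

lemma orbit_complement_stable:
  assumes "permutation \<sigma>" "\<sigma> b \<in> set (support \<sigma> a)"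
  shows "b \<in> set (support \<sigma> a)"
proof -
  have "\<sigma> b \<in> set (support \<sigma> b)"
    unfolding support_set[OF assms(1)] by (metis funpow_0 funpow.simps(2) o_apply rangeI)
  then have "set (support \<sigma> b) \<inter> set (support \<sigma> a) \<noteq> {}"
    using assms(2) by blast
  then show ?thesis using disjoint_support'[OF assms(1)] by metis
qed

lemma cycle_cover_exists:
  assumes "permutation \<sigma>" "finite S" "\<And>a. a \<in> S \<Longrightarrow> \<sigma> a \<in> S"
  shows "\<exists>ws. [] \<notin> set ws \<and> distinct (concat ws) \<and> set (concat ws) = S \<and>
    (\<forall>w\<in>set ws. map \<sigma> w = rotate1 w)"
  using assms(2,3)
proof (induction "card S" arbitrary: S rule: less_induct)
  case less
  show ?case
  proof (cases "S = {}")
    case True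
    then show ?thesis by (intro exI[of _ "[]"]) simp
  next
    case False
    then obtain a where a: "a \<in> S" by blast
    let ?w = "support \<sigma> a"
    have ne: "?w \<noteq> []" using least_power_of_permutation(2)[OF assms(1), of a] by simp
    have aw: "a \<in> set ?w"
      unfolding support_set[OF assms(1)] by (metis funpow_0 rangeI)
    have sub: "set ?w \<subseteq> S"
      unfolding support_set[OF assms(1)] using funpow_stable[of S \<sigma> a] less.prems(2) a by blast
    have "card (S - set ?w) < card S"
      using a aw less.prems(1) by (intro psubset_card_mono) blast+
    moreover have "\<sigma> b \<in> S - set ?w" if "b \<in> S - set ?w" for b
      using that less.prems(2) orbit_complement_stable[OF assms(1)] by blast
    ultimately obtain ws where ws: "[] \<notin> set ws" "distinct (concat ws)"
      "set (concat ws) = S - set ?w" "\<forall>w\<in>set ws. map \<sigma> w = rotate1 w"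
      using less.hyps[of "S - set ?w"] less.prems(1) by blast
    have "[] \<notin> set (?w # ws)" using ws(1) ne by auto
    moreover have "distinct (concat (?w # ws))"
      unfolding concat.simps distinct_append
      using cycle_of_permutation[OF assms(1)] ws(2,3) by blast
    moreover have "set (concat (?w # ws)) = S"
      unfolding concat.simps set_append using ws(3) sub by blast
    moreover have "\<forall>v\<in>set (?w # ws). map \<sigma> v = rotate1 v"
      using ws(4) support_is_cycle[OF assms(1), of a] by (metis set_ConsD)
    ultimately show ?thesis by blast
  qed
qed

lemma is_cycle_form_exists:
  assumes "\<sigma> permutes {1..m}"
  shows "is_cycle_form m \<sigma> (cycle_form m \<sigma>)"
proof -
  have p: "permutation \<sigma>"
    using assms permutation_permutes by blast
  have "\<exists>ws. is_cycle_form m \<sigma> ws"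
    unfolding is_cycle_form_def
    using cycle_cover_exists[OF p, of "{1..m}"] permutes_in_image[OF assms] by blast
  then show ?thesis unfolding cycle_form_def by (rule someI_ex)
qed

lemma is_cycle_form_last_exists:
  assumes "\<sigma> permutes {1..m}" "m \<ge> 1"
  shows "is_cycle_form m \<sigma> (cycle_form_last m \<sigma>) \<and> last (last (cycle_form_last m \<sigma>)) = m"
proof -
  have p: "permutation \<sigma>"
    using assms permutation_permutes by blast
  let ?w = "support \<sigma> (\<sigma> m)"
  let ?L = "least_power \<sigma> (\<sigma> m)"
  have mm: "\<sigma> m \<in> {1..m}" using assms permutes_in_image[OF assms(1), of m] by simp
  have L: "?L > 0" "(\<sigma> ^^ ?L) (\<sigma> m) = \<sigma> m"
    using least_power_of_permutation[OF p] by auto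
  then have "\<sigma> ((\<sigma> ^^ (?L - 1)) (\<sigma> m)) = \<sigma> m"
    by (metis Suc_diff_1 funpow.simps(2) o_apply)
  then have "(\<sigma> ^^ (?L - 1)) (\<sigma> m) = m"
    using permutes_inj[OF assms(1)] by (meson injD)
  then have lst: "last ?w = m"
    using L(1) by (simp add: last_map)
  have ne: "?w \<noteq> []" using L(1) by simp
  have sub: "set ?w \<subseteq> {1..m}"
    unfolding support_set[OF p]
    using funpow_stable[of "{1..m}" \<sigma> "\<sigma> m"] permutes_in_image[OF assms(1)] mm by blast
  have "\<sigma> b \<in> {1..m} - set ?w" if "b \<in> {1..m} - set ?w" for b
    using that permutes_in_image[OF assms(1)] orbit_complement_stable[OF p] by blast
  then obtain ws where ws: "[] \<notin> set ws" "distinct (concat ws)"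
      "set (concat ws) = {1..m} - set ?w" "\<forall>w\<in>set ws. map \<sigma> w = rotate1 w"
    using cycle_cover_exists[OF p, of "{1..m} - set ?w"] by blast
  have "[] \<notin> set (ws @ [?w])" using ws(1) ne by auto
  moreover have "distinct (concat (ws @ [?w]))"
    unfolding concat_append concat.simps append_Nil2 distinct_append
    using cycle_of_permutation[OF p] ws(2,3) by blast
  moreover have "set (concat (ws @ [?w])) = {1..m}"
    unfolding concat_append concat.simps append_Nil2 set_append using ws(3) sub by blast
  moreover have "\<forall>v\<in>set (ws @ [?w]). map \<sigma> v = rotate1 v"
    unfolding set_append using ws(4) support_is_cycle[OF p, of "\<sigma> m"] by auto
  ultimately have "is_cycle_form m \<sigma> (ws @ [?w]) \<and> last (last (ws @ [?w])) = m"
    unfolding is_cycle_form_def using lst by simp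
  then show ?thesis unfolding cycle_form_last_def by (rule someI)
qed

lemma sorting_perm_unique:
  assumes "distinct xs"
  shows "\<exists>!p. p permutes {..<length xs} \<and> sorted (permute_list p xs)"
proof -
  obtain p where p: "p permutes {..<length xs}" "permute_list p xs = sort xs"
    using mset_eq_permutation[of "sort xs" xs] by auto
  show ?thesis
  proof (rule ex1I[of _ p])
    show "p permutes {..<length xs} \<and> sorted (permute_list p xs)" using p by simp
  next
    fix q assume q: "q permutes {..<length xs} \<and> sorted (permute_list q xs)"
    then have "permute_list q xs = sort xs"
      by (metis mset_permute_list mset_sort properties_for_sort)
    then have eq: "xs ! q i = xs ! p i" if "i < length xs" for i
      using that p q permute_list_nth by metis
    show "q = p"
    proof
      fix i show "q i = p i"
      proof (cases "i < length xs")
        case True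
        then have "q i < length xs" "p i < length xs"
          using p(1) q permutes_in_image by (metis lessThan_iff)+
        then show ?thesis using eq[OF True] assms nth_eq_iff_index_eq by blast
      next
        case False
        then show ?thesis using p(1) q permutes_not_in by (metis lessThan_iff)
      qed
    qed
  qed
qed

theorem matrix_superalgebra_with_trace:
  fixes smul :: "complex \<Rightarrow> 'a::ring_1 \<Rightarrow> 'a"
  assumes "supercommutative_superalgebra smul (*) 1 grade"
  shows "superalgebra_with_trace (matrix_scale smul :: complex \<Rightarrow> 'a^'n::finite^'n \<Rightarrow> _)
    (**) (mat 1) (matrix_grade grade) matrix_tr"
proof -
  interpret A: supercommutative_superalgebra smul "(*)" 1 grade by fact
  have vs: "vector_space (matrix_scale smul :: complex \<Rightarrow> 'a^'n^'n \<Rightarrow> _)"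
    by unfold_locales
      (simp_all add: matrix_scale_def vec_eq_iff A.scale_right_distrib A.scale_left_distrib)
  interpret V: vector_space "matrix_scale smul :: complex \<Rightarrow> 'a^'n^'n \<Rightarrow> _" by (fact vs)
  have sum_grade: "(\<Sum>k\<in>I. g k) \<in> grade i" if "\<And>k. k \<in> I \<Longrightarrow> g k \<in> grade i"
    for I :: "'n set" and g i
    using A.subspace_sum[OF A.grade_subspace] that by blast
  have zero_grade: "0 \<in> grade i" for i
    using A.subspace_0[OF A.grade_subspace] .
  have tr_grade: "trace M \<in> grade i" if "M \<in> matrix_grade grade i" for M :: "'a^'n^'n" and i
    using that unfolding trace_def matrix_grade_def by (auto intro: sum_grade)
  have mat_mul_l: "mat c ** M = (\<chi> p q. c * M $ p $ q)" for c and M :: "'a^'n^'n"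
    by (simp add: matrix_matrix_mult_def mat_def vec_eq_iff if_distrib[of "\<lambda>t. t * _"] cong: if_cong)
  have mat_mul_r: "M ** mat c = (\<chi> p q. M $ p $ q * c)" for c and M :: "'a^'n^'n"
    by (simp add: matrix_matrix_mult_def mat_def vec_eq_iff if_distrib[of "\<lambda>t. _ * t"] cong: if_cong)
  have sc: "smul k a * b = smul k (a * b)" "a * smul k b = smul k (a * b)" for k a b
    by (fact A.mul_scale_left A.mul_scale_right)+
  show ?thesis
  proof (unfold_locales, goal_cases)
    case (1 a b c) show ?case by (simp add: matrix_mul_assoc)
  next
    case 2 show ?case by simp
  next
    case 3 show ?case by simp
  next
    case (4 a b c) show ?case
      by (simp add: matrix_matrix_mult_def vec_eq_iff distrib_right sum.distrib)
  next
    case (5 a b c) show ?case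
      by (simp add: matrix_matrix_mult_def vec_eq_iff distrib_left sum.distrib)
  next
    case (6 k a b) show ?case
      by (simp add: matrix_matrix_mult_def matrix_scale_def vec_eq_iff sc A.scale_sum_right)
  next
    case (7 a k b) show ?case
      by (simp add: matrix_matrix_mult_def matrix_scale_def vec_eq_iff sc A.scale_sum_right)
  next
    case (8 i) show ?case
      unfolding V.subspace_def matrix_grade_def matrix_scale_def
      using A.grade_subspace[of i] unfolding A.subspace_def by simp
  next
    case 9
    have "M = 0" if "M \<in> matrix_grade grade 0 \<inter> matrix_grade grade 1" for M :: "'a^'n^'n"
      using that A.grade_disjoint unfolding matrix_grade_def vec_eq_iff by auto
    then show ?case using zero_grade by (auto simp: matrix_grade_def)
  next
    case (10 M)
    obtain b c where "\<And>t. b t \<in> grade 0 \<and> c t \<in> grade 1 \<and> t = b t + c t"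
      using A.grade_decomp by metis
    then show ?case
      by (intro bexI[of _ "\<chi> p q. b (M $ p $ q)"] bexI[of _ "\<chi> p q. c (M $ p $ q)"])
        (auto simp: vec_eq_iff matrix_grade_def)
  next
    case (11 a i b j) then show ?case
      using A.grade_mul[of _ i _ j]
      by (simp add: matrix_grade_def matrix_matrix_mult_def sum_grade)
  next
    case 12 show ?case
      by (simp add: matrix_tr_def matrix_scale_def mat_def vec_eq_iff trace_def sum.distrib)
  next
    case 13 show ?case
      by (simp add: matrix_tr_def matrix_scale_def mat_def vec_eq_iff trace_def A.scale_sum_right)
  next
    case (14 a i) then show ?case
      using tr_grade[of a i] zero_grade by (auto simp: matrix_tr_def matrix_grade_def mat_def)
  next
    case (15 a i b j) then show ?case
      using A.supercomm[OF tr_grade]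
      by (auto simp: matrix_tr_def mat_mul_l mat_mul_r matrix_scale_def vec_eq_iff matrix_grade_def)
  next
    case (16 a i b j)
    have "trace (a ** b) = (\<Sum>p\<in>UNIV. \<Sum>q\<in>UNIV. a $ p $ q * b $ q $ p)"
      by (simp add: trace_def matrix_matrix_mult_def)
    also have "\<dots> = (\<Sum>p\<in>UNIV. \<Sum>q\<in>UNIV. smul (koszul_sign i j) (b $ q $ p * a $ p $ q))"
      using 16 by (intro sum.cong refl A.supercomm) (auto simp: matrix_grade_def)
    also have "\<dots> = (\<Sum>q\<in>UNIV. \<Sum>p\<in>UNIV. smul (koszul_sign i j) (b $ q $ p * a $ p $ q))"
      by (rule sum.swap)
    also have "\<dots> = smul (koszul_sign i j) (trace (b ** a))"
      by (simp add: trace_def matrix_matrix_mult_def A.scale_sum_right)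
    finally show ?case
      by (simp add: matrix_tr_def matrix_scale_def mat_def vec_eq_iff)
  next
    case (17 a i b j) show ?case
      unfolding matrix_tr_def mat_mul_l
      by (simp add: mat_def vec_eq_iff trace_def sum_distrib_left)
  qed
qed

end

theory Submission
  imports Defs
begin

text \<open>
  Let \<open>m = n + 1\<close>. Written out in matrix entries, a product of traces over the cycles of \<open>\<sigma>\<close> is the
  sum, over all labellings \<open>p : {1..m} \<rightarrow> {1..n}\<close>, of the products of the entries
  \<open>z\<^sub>k[p k, p (\<sigma> k)]\<close>, taken in the order in which the indices appear in the cycle form
  (\<open>trace_cycles_expansion\<close>). The entries commute or anticommute according to their parity, and the
  sign attached to \<open>\<Phi>\<^sub>\<sigma>\<close> is precisely the one produced by sorting the factors into the order
  \<open>1, \<dots>, m\<close> (\<open>fermionic_reordering\<close>). Hence, with all signs absorbed, the diagonal entries of the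
  scalar matrix \<open>T\<close> are \<open>\<Sum>p. \<Sum>\<sigma>. \<epsilon>\<^sub>\<sigma> z\<^sub>1[p 1, p (\<sigma> 1)] \<cdots> z\<^sub>m[p m, p (\<sigma> m)]\<close>. Since \<open>m > n\<close>, every \<open>p\<close>
  takes the same value at two indices \<open>a \<noteq> b\<close>. Replacing \<open>\<sigma>\<close> by \<open>(a b) \<sigma>\<close> leaves \<open>p \<circ> \<sigma>\<close> unchanged
  and reverses \<open>\<epsilon>\<^sub>\<sigma>\<close>, so the inner sum is zero for each \<open>p\<close> (\<open>sum_sign_permutations_repeated\<close>).

  The Cayley-Hamilton expression follows from the same computation. The \<open>(r, s)\<close> entry of the
  word \<open>z\<^sub>u\<close> is the trace of \<open>z\<^sub>u E\<^sub>s\<^sub>r\<close>, where \<open>E\<^sub>s\<^sub>r\<close> is a matrix unit. So the \<open>(r, s)\<close> entry of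
  \<open>\<Psi>\<^sub>\<sigma>\<close> is the expression \<open>\<Phi>\<^sub>\<sigma>\<close> in which \<open>z\<^sub>m\<close> is replaced by \<open>E\<^sub>s\<^sub>r\<close> and the index \<open>m\<close> counts as bosonic.
\<close>

section \<open>Reordering products of commuting and anticommuting elements\<close>

lemma prod_list_anticommute:
  fixes a :: "'a::ring_1"
  assumes "\<And>b. b \<in> set bs \<Longrightarrow> a * b = - (b * a)"
  shows "a * prod_list bs = (-1) ^ length bs * (prod_list bs * a)"
  using assms
proof (induction bs)
  case (Cons b bs)
  have ab: "a * b = - (b * a)" by (rule Cons.prems) simp
  have IH: "a * prod_list bs = (-1) ^ length bs * (prod_list bs * a)"
    by (rule Cons.IH) (rule Cons.prems, simp)
  have "a * (b * prod_list bs) = - (b * (a * prod_list bs))"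
    by (simp add: ab flip: mult.assoc)
  also have "\<dots> = - (b * ((-1) ^ length bs * (prod_list bs * a)))"
    by (simp only: IH)
  also have "\<dots> = (-1) ^ length (b # bs) * (b * prod_list bs * a)"
    by (cases "even (length bs)") (simp_all add: mult.assoc)
  finally show ?case by simp
qed simp

lemma prod_list_swap_anticommuting:
  fixes a b :: "'a::ring_1"
  assumes "\<And>c. c \<in> set cs \<Longrightarrow> a * c = - (c * a)" "\<And>c. c \<in> set cs \<Longrightarrow> b * c = - (c * b)"
    and "a * b = - (b * a)"
  shows "a * prod_list cs * b = - (b * prod_list cs * a)"
proof -
  let ?s = "(-1) ^ length cs :: 'a"
  have "a * prod_list cs * b = ?s * (prod_list cs * (a * b))"
    by (simp only: prod_list_anticommute[of cs a, OF assms(1)] mult.assoc)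
  also have "\<dots> = - (?s * (prod_list cs * (b * a)))"
    by (simp only: assms(3) mult_minus_right)
  also have "?s * (prod_list cs * (b * a)) = b * prod_list cs * a"
    by (simp only: prod_list_anticommute[of cs b, OF assms(2)] mult.assoc)
  finally show ?thesis .
qed

lemma permute_list_transpose:
  assumes "i < length xs" "j < length xs"
  shows "permute_list (Transposition.transpose i j) xs = xs[i := xs ! j, j := xs ! i]"
  using assms
  by (intro nth_equalityI)
     (auto simp: permute_list_def Transposition.transpose_def nth_list_update)

lemma permute_list_transpose_decomposition:
  assumes "i < j" "j < length xs"
  obtains us a vs b ws where "xs = us @ a # vs @ b # ws"
    and "permute_list (Transposition.transpose i j) xs = us @ b # vs @ a # ws"
proof -
  define us vs ws where "us = take i xs" "vs = take (j - Suc i) (drop (Suc i) xs)"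
    "ws = drop (Suc j) xs"
  define a b where "a = xs ! i" "b = xs ! j"
  have len: "length us = i" "length vs = j - Suc i"
    using assms by (auto simp: us_vs_ws_def)
  have "xs = us @ a # drop (Suc i) xs"
    using assms unfolding us_vs_ws_def a_b_def by (intro id_take_nth_drop) simp
  moreover have "drop (Suc i) xs = vs @ b # ws"
    using id_take_nth_drop[of "j - Suc i" "drop (Suc i) xs"] assms
    by (simp add: us_vs_ws_def a_b_def)
  ultimately have xs: "xs = us @ a # vs @ b # ws"
    by (rule subst[rotated])
  have "permute_list (Transposition.transpose i j) xs = xs[i := b, j := a]"
    unfolding a_b_def using assms by (intro permute_list_transpose) auto
  also have "\<dots> = us @ b # vs @ a # ws"
  proof -
    have "j = i + Suc (length vs)" using assms(1) len by simp
    then show ?thesis unfolding xs using len(1) by (simp add: list_update_append)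
  qed
  finally show thesis using that xs by blast
qed

text \<open>
  Exchanging two factors \<open>a\<close> and \<open>b\<close> of an anticommuting product moves each of them across the
  factors between them, which contributes two equal signs that cancel; the sign that remains comes
  from \<open>a b = - b a\<close>.
\<close>

lemma prod_list_transpose_anticommuting:
  fixes g :: "'b \<Rightarrow> 'a::ring_1"
  assumes "distinct xs" "i < length xs" "j < length xs" "i \<noteq> j"
    and anti: "\<And>k l. k \<in> set xs \<Longrightarrow> l \<in> set xs \<Longrightarrow> k \<noteq> l \<Longrightarrow> g k * g l = - (g l * g k)"
  shows "prod_list (map g (permute_list (Transposition.transpose i j) xs)) = - prod_list (map g xs)"
  using assms(2-4)
proof (induction i j rule: linorder_wlog)
  case (le i j)
  then have "i < j" by simp
  then obtain us a vs b ws where xs: "xs = us @ a # vs @ b # ws"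
    and ys: "permute_list (Transposition.transpose i j) xs = us @ b # vs @ a # ws"
    using permute_list_transpose_decomposition[OF _ le(3)] by metis
  have "g a * prod_list (map g vs) * g b = - (g b * prod_list (map g vs) * g a)"
  proof (rule prod_list_swap_anticommuting)
    have dist: "distinct (us @ a # vs @ b # ws)" using \<open>distinct xs\<close> unfolding xs .
    then show "g a * g b = - (g b * g a)" by (intro anti) (auto simp: xs)
    fix c assume "c \<in> set (map g vs)"
    then obtain k where k: "k \<in> set vs" "c = g k" by auto
    have "g a * g k = - (g k * g a)" using dist k(1) by (intro anti) (auto simp: xs)
    then show "g a * c = - (c * g a)" unfolding k(2) .
    have "g b * g k = - (g k * g b)" using dist k(1) by (intro anti) (auto simp: xs)
    then show "g b * c = - (c * g b)" unfolding k(2) .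
  qed
  then have "g a * prod_list (map g vs) * g b * prod_list (map g ws) =
      - (g b * prod_list (map g vs) * g a) * prod_list (map g ws)"
    by (rule arg_cong)
  then have "g a * (prod_list (map g vs) * (g b * prod_list (map g ws))) =
      - (g b * (prod_list (map g vs) * (g a * prod_list (map g ws))))"
    by (simp only: mult.assoc mult_minus_left)
  then show ?case unfolding ys by (simp add: xs)
next
  case (sym i j)
  then show ?case by (simp add: Transposition.transpose_commute)
qed

text \<open>
  Transpositions generate all permutations, and both the product and \<^const>\<open>sign\<close> change sign under
  each of them.
\<close>

lemma prod_list_permute_anticommuting:
  fixes g :: "'b \<Rightarrow> 'a::ring_1"
  assumes "p permutes {..<length xs}" "distinct xs"
    and "\<And>k l. k \<in> set xs \<Longrightarrow> l \<in> set xs \<Longrightarrow> k \<noteq> l \<Longrightarrow> g k * g l = - (g l * g k)"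
  shows "prod_list (map g (permute_list p xs)) = of_int (sign p) * prod_list (map g xs)"
proof -
  \<comment> \<open>Composing \<open>p\<close> with a transposition amounts to applying \<open>p\<close> to a rearranged list, so the induction
      runs over all rearrangements of \<open>xs\<close> at once.\<close>
  have "\<forall>ys. length ys = length xs \<longrightarrow> set ys = set xs \<longrightarrow> distinct ys \<longrightarrow>
     prod_list (map g (permute_list p ys)) = of_int (sign p) * prod_list (map g ys)"
    using assms(1) finite_lessThan
  proof (induction p rule: permutes_induct)
    case id
    then show ?case by simp
  next
    case (swap a b p)
    have ab: "Transposition.transpose a b permutes {..<length xs}"
      using swap.hyps by (intro permutes_swap_id)
    have sgn: "sign (Transposition.transpose a b \<circ> p) = - sign p"
      using swap.hyps permutes_imp_permutation[of "{..<length xs}" p]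
      by (simp add: sign_compose permutation_swap_id sign_swap_id)
    show ?case
    proof (intro allI impI)
      fix ys assume ys: "length ys = length xs" "set ys = set xs" "distinct ys"
      have "prod_list (map g (permute_list (Transposition.transpose a b \<circ> p) ys)) =
          prod_list (map g (permute_list p (permute_list (Transposition.transpose a b) ys)))"
        using swap.hyps ys by (subst permute_list_compose) auto
      also have "\<dots> = of_int (sign p) * prod_list (map g (permute_list (Transposition.transpose a b) ys))"
        by (rule swap.IH[rule_format]) (use ys ab in auto)
      also have "prod_list (map g (permute_list (Transposition.transpose a b) ys)) =
          - prod_list (map g ys)"
        by (rule prod_list_transpose_anticommuting) (use swap.hyps ys in \<open>auto intro!: assms(3)\<close>)
      finally show "prod_list (map g (permute_list (Transposition.transpose a b \<circ> p) ys)) =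
          of_int (sign (Transposition.transpose a b \<circ> p)) * prod_list (map g ys)"
        unfolding sgn by (simp add: comp_def)
    qed
  qed
  then show ?thesis using assms(2) by blast
qed

lemma prod_list_sort_anticommuting:
  fixes g :: "nat \<Rightarrow> 'a::ring_1"
  assumes "distinct xs"
    and "\<And>k l. k \<in> set xs \<Longrightarrow> l \<in> set xs \<Longrightarrow> k \<noteq> l \<Longrightarrow> g k * g l = - (g l * g k)"
  shows "of_int (sign (sorting_perm xs)) * prod_list (map g xs) = prod_list (map g (sort xs))"
proof -
  have p: "sorting_perm xs permutes {..<length xs}" "sorted (permute_list (sorting_perm xs) xs)"
    using theI'[OF sorting_perm_unique[OF assms(1)]] unfolding sorting_perm_def by auto
  then have "permute_list (sorting_perm xs) xs = sort xs"
    by (metis mset_permute_list properties_for_sort)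
  then show ?thesis using prod_list_permute_anticommuting[OF p(1) assms] by simp
qed

lemma prod_list_insort_commuting:
  fixes g :: "'b::linorder \<Rightarrow> 'a::monoid_mult"
  assumes "\<And>j. j \<in> set xs \<Longrightarrow> g i * g j = g j * g i"
  shows "prod_list (map g (insort i xs)) = g i * prod_list (map g xs)"
  using assms
proof (induction xs)
  case (Cons j xs)
  have "g i * g j = g j * g i" by (rule Cons.prems) simp
  then have "g j * (g i * prod_list (map g xs)) = g i * (g j * prod_list (map g xs))"
    by (simp flip: mult.assoc)
  moreover have "prod_list (map g (insort i xs)) = g i * prod_list (map g xs)"
    by (rule Cons.IH) (rule Cons.prems, simp)
  ultimately show ?case by simp
qed simp

lemma prod_list_sort_commuting:
  fixes g :: "'b::linorder \<Rightarrow> 'a::monoid_mult"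
  assumes "distinct xs"
    and "\<And>k l. k \<in> set xs \<Longrightarrow> l \<in> set xs \<Longrightarrow> k \<noteq> l \<Longrightarrow> g k * g l = g l * g k"
  shows "prod_list (map g (sort xs)) = prod_list (map g xs)"
  using assms
proof (induction xs)
  case (Cons i xs)
  have "prod_list (map g (insort i (sort xs))) = g i * prod_list (map g (sort xs))"
    by (rule prod_list_insort_commuting, rule Cons.prems(2)) (use Cons.prems(1) in auto)
  moreover have "prod_list (map g (sort xs)) = prod_list (map g xs)"
    by (rule Cons.IH) (use Cons.prems(1) in simp, rule Cons.prems(2), simp_all)
  ultimately show ?case by simp
qed simp

lemma prod_list_commute_if:
  fixes a :: "'a::monoid_mult"
  assumes "\<And>b. b \<in> set bs \<Longrightarrow> b * a = a * b"
  shows "prod_list bs * a = a * prod_list bs"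
  using assms
proof (induction bs)
  case (Cons b bs)
  have IH: "prod_list bs * a = a * prod_list bs"
    by (rule Cons.IH) (rule Cons.prems, simp)
  have "b * a = a * b" by (rule Cons.prems) simp
  with IH show ?case by (metis mult.assoc prod_list.Cons)
qed simp

lemma prod_list_partition:
  fixes g :: "'b \<Rightarrow> 'a::monoid_mult"
  assumes "distinct xs"
    and "\<And>k l. k \<in> set xs \<Longrightarrow> l \<in> set xs \<Longrightarrow> k \<noteq> l \<Longrightarrow> \<not> F k \<Longrightarrow> g k * g l = g l * g k"
  shows "prod_list (map g xs) =
    prod_list (map g (filter F xs)) * prod_list (map g (filter (\<lambda>i. \<not> F i) xs))"
  using assms
proof (induction xs)
  case (Cons i xs)
  have comm: "prod_list (map g (filter F xs)) * g i = g i * prod_list (map g (filter F xs))"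
    if "\<not> F i"
  proof (rule prod_list_commute_if)
    fix b assume "b \<in> set (map g (filter F xs))"
    then obtain j where j: "j \<in> set xs" "b = g j" by auto
    with Cons.prems(1) have "i \<noteq> j" by auto
    then have "g i * g j = g j * g i"
      by (intro Cons.prems(2)) (simp_all add: that j(1))
    then show "b * g i = g i * b" by (simp only: j(2))
  qed
  have IH: "prod_list (map g xs) =
    prod_list (map g (filter F xs)) * prod_list (map g (filter (\<lambda>i. \<not> F i) xs))"
    by (rule Cons.IH) (use Cons.prems(1) in simp, rule Cons.prems(2), simp_all)
  show ?case
  proof (cases "F i")
    case True
    then show ?thesis using IH by (simp add: mult.assoc)
  next
    case False
    then have "prod_list (map g (filter F xs)) * (g i * prod_list (map g (filter (\<lambda>i. \<not> F i) xs))) =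
      g i * prod_list (map g xs)"
      using IH comm by (metis mult.assoc)
    then show ?thesis using False by simp
  qed
qed simp

text \<open>
  This is what the sign in \<open>\<Phi>\<close> and \<open>\<Psi>\<close> is made for: it absorbs exactly the sign that arises when
  a product of homogeneous elements is brought into increasing order. Bosonic factors can be pulled
  out to the right of the fermionic ones and rearranged at no cost, so only the order of the
  fermionic indices matters.
\<close>

lemma fermionic_reordering:
  fixes g :: "nat \<Rightarrow> 'a::ring_1"
  assumes dist: "distinct xs"
    and scomm: "\<And>k l. k \<in> set xs \<Longrightarrow> l \<in> set xs \<Longrightarrow> k \<noteq> l \<Longrightarrow>
      g k * g l = (if F k \<and> F l then - (g l * g k) else g l * g k)"
  shows "of_int (sign (sorting_perm (filter F xs))) * prod_list (map g xs) =
    prod_list (map g (sort xs))"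
proof -
  let ?B = "\<lambda>i. \<not> F i"
  have odd: "g k * g l = - (g l * g k)"
    if "k \<in> set xs" "l \<in> set xs" "k \<noteq> l" "F k" "F l" for k l
    using scomm[OF that(1-3)] that(4,5) by simp
  have even: "g k * g l = g l * g k"
    if "k \<in> set xs" "l \<in> set xs" "k \<noteq> l" "\<not> F k" for k l
    using scomm[OF that(1-3)] that(4) by simp
  have split: "prod_list (map g xs) =
      prod_list (map g (filter F xs)) * prod_list (map g (filter ?B xs))"
    using dist even by (rule prod_list_partition)
  have split_sort: "prod_list (map g (sort xs)) =
      prod_list (map g (filter F (sort xs))) * prod_list (map g (filter ?B (sort xs)))"
    by (rule prod_list_partition) (use dist in \<open>auto intro: even\<close>)
  have "of_int (sign (sorting_perm (filter F xs))) * prod_list (map g (filter F xs)) =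
      prod_list (map g (sort (filter F xs)))"
    by (rule prod_list_sort_anticommuting) (use dist in \<open>auto intro: odd\<close>)
  moreover have "prod_list (map g (sort (filter ?B xs))) = prod_list (map g (filter ?B xs))"
    by (rule prod_list_sort_commuting) (use dist in \<open>auto intro: even\<close>)
  ultimately show ?thesis
    unfolding split split_sort by (simp add: filter_sort flip: mult.assoc)
qed


section \<open>Products of traces as sums over labellings\<close>

lemma sum_PiE_insert:
  assumes "i \<notin> S"
  shows "(\<Sum>p\<in>PiE (insert i S) T. h p) = (\<Sum>a\<in>T i. \<Sum>p\<in>PiE S T. h (p(i := a)))"
proof -
  have "(\<Sum>p\<in>PiE (insert i S) T. h p) = (\<Sum>(a, p)\<in>T i \<times> PiE S T. h (p(i := a)))"
    unfolding PiE_insert_eq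
    by (subst sum.reindex[OF inj_combinator[OF assms]]) (simp add: case_prod_unfold comp_def)
  then show ?thesis by (simp add: sum.cartesian_product)
qed

lemma sum_PiE_mult_disjoint:
  fixes f g :: "('i \<Rightarrow> 'b) \<Rightarrow> 'a::semiring_0"
  assumes "A \<inter> B = {}"
    and f: "\<And>p q. (\<And>i. i \<in> A \<Longrightarrow> p i = q i) \<Longrightarrow> f p = f q"
    and g: "\<And>p q. (\<And>i. i \<in> B \<Longrightarrow> p i = q i) \<Longrightarrow> g p = g q"
  shows "(\<Sum>p\<in>PiE A T. f p) * (\<Sum>q\<in>PiE B T. g q) = (\<Sum>p\<in>PiE (A \<union> B) T. f p * g p)"
proof -
  have "(\<Sum>p\<in>PiE A T. f p) * (\<Sum>q\<in>PiE B T. g q) =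
    (\<Sum>(p, q)\<in>PiE A T \<times> PiE B T. f p * g q)"
    by (simp add: sum_product sum.cartesian_product)
  also have "\<dots> = (\<Sum>p\<in>PiE (A \<union> B) T. f p * g p)"
    by (rule sum.reindex_bij_witness[where
          j = "\<lambda>(p, q) i. if i \<in> A then p i else q i" and
          i = "\<lambda>p. (restrict p A, restrict p B)"])
       (use assms(1) in \<open>auto simp: fun_eq_iff PiE_iff extensional_def restrict_def disjoint_iff
          intro!: arg_cong2[where f = "(*)"] f g\<close>)
  finally show ?thesis .
qed

abbreviation matrix_word :: "('i \<Rightarrow> 'a::semiring_1^'n^'n) \<Rightarrow> 'i list \<Rightarrow> 'a^'n^'n" where
  "matrix_word z w \<equiv> foldr (**) (map z w) (mat 1)"

text \<open>
  The sum over paths: \<open>p\<close> labels each letter of \<open>v\<close> with the row index of its matrix, the first row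
  index \<open>a\<close> and the last column index \<open>s\<close> being prescribed. Since the letters are distinct, the labels
  can be chosen as a function of the letter rather than of its position.
\<close>

lemma matrix_word_entry:
  fixes z :: "'i \<Rightarrow> 'a::semiring_1^'n::finite^'n"
  assumes "distinct v"
  shows "matrix_word z (i # v) $ a $ s =
    (\<Sum>p\<in>PiE (set v) (\<lambda>_. UNIV). prod_list (map (\<lambda>(k, b, c). z k $ b $ c)
       (zip (i # v) (zip (a # map p v) (map p v @ [s])))))"
  using assms
proof (induction v arbitrary: i a)
  case (Cons j v)
  have "matrix_word z (i # j # v) $ a $ s = (\<Sum>b\<in>UNIV. z i $ a $ b * matrix_word z (j # v) $ b $ s)"
    by (simp add: matrix_matrix_mult_def)
  also have "\<dots> = (\<Sum>b\<in>UNIV. \<Sum>p\<in>PiE (set v) (\<lambda>_. UNIV). z i $ a $ b *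
       prod_list (map (\<lambda>(k, b, c). z k $ b $ c)
         (zip (j # v) (zip (b # map p v) (map p v @ [s])))))"
    by (subst Cons.IH) (use Cons.prems in \<open>simp_all add: sum_distrib_left\<close>)
  also have "\<dots> = (\<Sum>b\<in>UNIV. \<Sum>p\<in>PiE (set v) (\<lambda>_. UNIV). 
       prod_list (map (\<lambda>(k, b, c). z k $ b $ c)
         (zip (i # j # v) (zip (a # map (p(j := b)) (j # v)) (map (p(j := b)) (j # v) @ [s])))))"
  proof -
    have "map (p(j := b)) v = map p v" for p :: "'i \<Rightarrow> 'n" and b
      using Cons.prems by auto
    then show ?thesis
      by (simp only: list.map zip_Cons_Cons fun_upd_same append_Cons prod_list.Cons prod.case)
  qed
  also have "\<dots> = (\<Sum>p\<in>PiE (insert j (set v)) (\<lambda>_. UNIV). 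
       prod_list (map (\<lambda>(k, b, c). z k $ b $ c)
         (zip (i # j # v) (zip (a # map p (j # v)) (map p (j # v) @ [s])))))"
    by (rule sum_PiE_insert[symmetric]) (use Cons.prems in auto)
  finally show ?case by simp
qed simp

lemma zip_map3: "zip w (zip (map f w) (map g w)) = map (\<lambda>k. (k, f k, g k)) w"
  by (induction w) auto

text \<open>
  Taking the trace closes the path: the column index of the last letter becomes the row index of the
  first, so along a cycle of \<open>\<sigma>\<close> the column index of the letter \<open>k\<close> is the label of \<open>\<sigma> k\<close>. In this
  form the cycle structure enters only through \<open>p \<circ> \<sigma>\<close>.
\<close>

lemma trace_cycle_expansion:
  fixes z :: "'i \<Rightarrow> 'a::semiring_1^'n::finite^'n"
  assumes "distinct w" "w \<noteq> []" and rot: "map \<sigma> w = rotate1 w"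
  shows "trace (matrix_word z w) =
    (\<Sum>p\<in>PiE (set w) (\<lambda>_. UNIV). prod_list (map (\<lambda>k. z k $ p k $ p (\<sigma> k)) w))"
proof -
  obtain i v where w: "w = i # v" using assms(2) by (cases w) auto
  have *: "zip (i # v) (zip (a # map p v) (map p v @ [a])) =
    map (\<lambda>k. (k, (p(i := a)) k, (p(i := a)) (\<sigma> k))) w" for p :: "'i \<Rightarrow> 'n" and a
  proof -
    let ?q = "p(i := a)"
    have q: "map ?q v = map p v" using assms(1) w by auto
    have "map p v @ [a] = map ?q (rotate1 w)" using q w by simp
    also have "\<dots> = map (\<lambda>k. ?q (\<sigma> k)) w"
      unfolding rot[symmetric] by simp
    finally have A: "map p v @ [a] = map (\<lambda>k. ?q (\<sigma> k)) w" .
    have B: "a # map p v = map ?q w" using q w by simp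
    show ?thesis unfolding w[symmetric] A B by (rule zip_map3)
  qed
  have "matrix_word z w $ a $ a = (\<Sum>p\<in>PiE (set v) (\<lambda>_. UNIV).
      prod_list (map (\<lambda>k. z k $ (p(i := a)) k $ (p(i := a)) (\<sigma> k)) w))" for a
  proof -
    have "matrix_word z w $ a $ a = (\<Sum>p\<in>PiE (set v) (\<lambda>_. UNIV).
        prod_list (map (\<lambda>(k, b, c). z k $ b $ c)
          (zip (i # v) (zip (a # map p v) (map p v @ [a])))))"
      unfolding w by (rule matrix_word_entry) (use assms(1) w in simp)
    then show ?thesis by (simp only: * map_map comp_def prod.case)
  qed
  then have "trace (matrix_word z w) = (\<Sum>a\<in>UNIV. \<Sum>p\<in>PiE (set v) (\<lambda>_. UNIV).
      prod_list (map (\<lambda>k. z k $ (p(i := a)) k $ (p(i := a)) (\<sigma> k)) w))"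
    unfolding trace_def by simp
  also have "\<dots> = (\<Sum>p\<in>PiE (insert i (set v)) (\<lambda>_. UNIV).
      prod_list (map (\<lambda>k. z k $ p k $ p (\<sigma> k)) w))"
    by (rule sum_PiE_insert[symmetric]) (use assms(1) w in auto)
  finally show ?thesis using w by simp
qed

lemma trace_cycles_expansion:
  fixes z :: "'i \<Rightarrow> 'a::semiring_1^'n::finite^'n"
  assumes "distinct (concat ws)" "[] \<notin> set ws" "\<And>w. w \<in> set ws \<Longrightarrow> map \<sigma> w = rotate1 w"
  shows "prod_list (map (\<lambda>w. trace (matrix_word z w)) ws) =
    (\<Sum>p\<in>PiE (set (concat ws)) (\<lambda>_. UNIV). prod_list (map (\<lambda>k. z k $ p k $ p (\<sigma> k)) (concat ws)))"
  using assms
proof (induction ws)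
  case (Cons w ws)
  let ?t = "\<lambda>p k. z k $ p k $ p (\<sigma> k)"
  have closed: "\<sigma> k \<in> set v" if "k \<in> set v" "v \<in> set (w # ws)" for k v
    using Cons.prems(3)[OF that(2)] that(1) by (metis image_eqI set_map set_rotate1)
  have "trace (matrix_word z w) = (\<Sum>p\<in>PiE (set w) (\<lambda>_. UNIV). prod_list (map (?t p) w))"
    by (rule trace_cycle_expansion) (use Cons.prems(1,2) in simp, use Cons.prems(2) in auto,
        rule Cons.prems(3), simp)
  moreover have "prod_list (map (\<lambda>w. trace (matrix_word z w)) ws) =
    (\<Sum>p\<in>PiE (set (concat ws)) (\<lambda>_. UNIV). prod_list (map (?t p) (concat ws)))"
    by (rule Cons.IH) (use Cons.prems(1,2) in simp, use Cons.prems(2) in simp,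
        rule Cons.prems(3), simp)
  ultimately have "prod_list (map (\<lambda>w. trace (matrix_word z w)) (w # ws)) =
    (\<Sum>p\<in>PiE (set w) (\<lambda>_. UNIV). prod_list (map (?t p) w)) *
    (\<Sum>p\<in>PiE (set (concat ws)) (\<lambda>_. UNIV). prod_list (map (?t p) (concat ws)))"
    by simp
  also have "\<dots> = (\<Sum>p\<in>PiE (set w \<union> set (concat ws)) (\<lambda>_. UNIV).
      prod_list (map (?t p) w) * prod_list (map (?t p) (concat ws)))"
  proof (rule sum_PiE_mult_disjoint)
    show "set w \<inter> set (concat ws) = {}" using Cons.prems(1) by auto
  next
    fix p q :: "'i \<Rightarrow> 'n" assume "\<And>i. i \<in> set w \<Longrightarrow> p i = q i"
    then have "map (?t p) w = map (?t q) w" using closed by auto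
    then show "prod_list (map (?t p) w) = prod_list (map (?t q) w)" by (rule arg_cong)
  next
    fix p q :: "'i \<Rightarrow> 'n" assume pq: "\<And>i. i \<in> set (concat ws) \<Longrightarrow> p i = q i"
    have "map (?t p) (concat ws) = map (?t q) (concat ws)"
    proof (rule map_cong[OF refl])
      fix k assume "k \<in> set (concat ws)"
      moreover from this have "\<sigma> k \<in> set (concat ws)" using closed by auto
      ultimately show "?t p k = ?t q k" using pq by simp
    qed
    then show "prod_list (map (?t p) (concat ws)) = prod_list (map (?t q) (concat ws))" by (rule arg_cong)
  qed
  finally show ?case by simp
qed simp


section \<open>The alternating sum over permutations\<close>

text \<open>
  A determinant with two equal columns: \<open>\<sigma> \<mapsto> (a b) \<sigma>\<close> preserves \<open>q \<circ> \<sigma>\<close> and reverses the sign. Pairing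
  even with odd permutations, rather than deriving \<open>S = - S\<close>, keeps this valid over any ring.
\<close>

lemma sum_sign_permutations_repeated:
  fixes H :: "('i \<Rightarrow> 'b) \<Rightarrow> 'a::ring_1"
  assumes "finite S" "a \<in> S" "b \<in> S" "a \<noteq> b" "q a = q b"
  shows "(\<Sum>\<sigma> | \<sigma> permutes S. of_int (sign \<sigma>) * H (\<lambda>k. q (\<sigma> k))) = (0::'a)"
proof -
  let ?P = "{\<sigma>. \<sigma> permutes S}"
  let ?t = "Transposition.transpose a b"
  let ?f = "\<lambda>\<sigma>. of_int (sign \<sigma>) * H (\<lambda>k. q (\<sigma> k)) :: 'a"
  have t: "?t permutes S" using assms by (intro permutes_swap_id)
  have perm: "permutation \<sigma>" if "\<sigma> permutes S" for \<sigma>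
    using that assms(1) permutes_imp_permutation by blast
  have sgn: "sign (?t \<circ> \<sigma>) = - sign \<sigma>" if "\<sigma> permutes S" for \<sigma>
    using perm[OF that] assms(4) by (simp add: sign_compose permutation_swap_id sign_swap_id)
  have qt: "q (?t k) = q k" for k using assms(5) by (simp add: Transposition.transpose_def)
  have fin: "finite ?P" using finite_permutations[OF assms(1)] .
  have "sum ?f {\<sigma>\<in>?P. \<not> evenperm \<sigma>} = (\<Sum>\<sigma>\<in>{\<sigma>\<in>?P. evenperm \<sigma>}. - ?f \<sigma>)"
  proof (rule sum.reindex_bij_witness[where i = "\<lambda>\<sigma>. ?t \<circ> \<sigma>" and j = "\<lambda>\<sigma>. ?t \<circ> \<sigma>"])
    fix \<sigma> assume \<sigma>: "\<sigma> \<in> {\<sigma>\<in>?P. \<not> evenperm \<sigma>}"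
    then show "?t \<circ> \<sigma> \<in> {\<sigma>\<in>?P. evenperm \<sigma>}"
      using sgn[of \<sigma>] permutes_compose[OF _ t, of \<sigma>] by (auto simp: sign_def split: if_splits)
    show "- ?f (?t \<circ> \<sigma>) = ?f \<sigma>" using sgn[of \<sigma>] \<sigma> by (simp add: qt)
  next
    fix \<sigma> assume \<sigma>: "\<sigma> \<in> {\<sigma>\<in>?P. evenperm \<sigma>}"
    then show "?t \<circ> \<sigma> \<in> {\<sigma>\<in>?P. \<not> evenperm \<sigma>}"
      using sgn[of \<sigma>] permutes_compose[OF _ t, of \<sigma>] by (auto simp: sign_def split: if_splits)
  qed (simp_all add: fun_eq_iff)
  moreover have "sum ?f ?P = sum ?f {\<sigma>\<in>?P. evenperm \<sigma>} + sum ?f {\<sigma>\<in>?P. \<not> evenperm \<sigma>}"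
    by (subst sum.union_disjoint[symmetric]) (use fin in \<open>auto intro: sum.cong\<close>)
  ultimately show ?thesis by (simp add: sum_negf)
qed

text \<open>
  The common core of both identities. It is stated for an arbitrary set \<open>F\<close> of fermionic indices,
  because the second identity needs the last index to become bosonic, and for an arbitrary choice
  of cycle forms, because the two identities display the cycles differently.
\<close>

lemma signed_cycle_trace_sum_eq_0:
  fixes z :: "nat \<Rightarrow> 'a::ring_1^'n::finite^'n"
  assumes m: "m > CARD('n)"
    and scomm: "\<And>k l p q p' q'. k \<in> {1..m} \<Longrightarrow> l \<in> {1..m} \<Longrightarrow> k \<noteq> l \<Longrightarrow>
      z k $ p $ q * z l $ p' $ q' =
        (if F k \<and> F l then - (z l $ p' $ q' * z k $ p $ q) else z l $ p' $ q' * z k $ p $ q)"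
    and ws: "\<And>\<sigma>. \<sigma> permutes {1..m} \<Longrightarrow> is_cycle_form m \<sigma> (ws \<sigma>)"
  shows "(\<Sum>\<sigma> | \<sigma> permutes {1..m}. of_int (sign \<sigma>) *
      (of_int (sign (sorting_perm (filter F (concat (ws \<sigma>))))) *
        prod_list (map (\<lambda>w. trace (matrix_word z w)) (ws \<sigma>)))) = 0"
proof -
  let ?P = "{\<sigma>. \<sigma> permutes {1..m}}"
  let ?Q = "PiE {1..m} (\<lambda>_. UNIV :: 'n set)"
  define H :: "(nat \<Rightarrow> 'n) \<Rightarrow> (nat \<Rightarrow> 'n) \<Rightarrow> 'a"
    where "H q r = prod_list (map (\<lambda>k. z k $ q k $ r k) [1..<Suc m])" for q r
  have expand: "of_int (sign (sorting_perm (filter F (concat (ws \<sigma>))))) *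
        prod_list (map (\<lambda>w. trace (matrix_word z w)) (ws \<sigma>)) =
      (\<Sum>q\<in>?Q. H q (\<lambda>k. q (\<sigma> k)))" if \<sigma>: "\<sigma> permutes {1..m}" for \<sigma>
  proof -
    have cf: "[] \<notin> set (ws \<sigma>)" "distinct (concat (ws \<sigma>))" "set (concat (ws \<sigma>)) = {1..m}"
      "\<And>w. w \<in> set (ws \<sigma>) \<Longrightarrow> map \<sigma> w = rotate1 w"
      using ws[OF \<sigma>] unfolding is_cycle_form_def by auto
    have srt: "sort (concat (ws \<sigma>)) = [1..<Suc m]"
      using cf(2,3) by (intro sorted_distinct_set_unique) (auto simp del: upt_Suc)
    have "of_int (sign (sorting_perm (filter F (concat (ws \<sigma>))))) *
        prod_list (map (\<lambda>k. z k $ q k $ q (\<sigma> k)) (concat (ws \<sigma>))) = H q (\<lambda>k. q (\<sigma> k))" for q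
      unfolding H_def srt[symmetric]
      by (rule fermionic_reordering[OF cf(2) scomm]) (simp_all add: cf(3) del: set_concat)
    then show ?thesis
      using trace_cycles_expansion[where z = z and \<sigma> = \<sigma>, OF cf(2,1,4)] cf(3)
      by (simp add: sum_distrib_left)
  qed
  have "(\<Sum>\<sigma>\<in>?P. of_int (sign \<sigma>) *
      (of_int (sign (sorting_perm (filter F (concat (ws \<sigma>))))) *
        prod_list (map (\<lambda>w. trace (matrix_word z w)) (ws \<sigma>)))) =
    (\<Sum>\<sigma>\<in>?P. \<Sum>q\<in>?Q. of_int (sign \<sigma>) * H q (\<lambda>k. q (\<sigma> k)))"
    by (intro sum.cong refl) (simp add: expand sum_distrib_left)
  also have "\<dots> = (\<Sum>q\<in>?Q. \<Sum>\<sigma>\<in>?P. of_int (sign \<sigma>) * H q (\<lambda>k. q (\<sigma> k)))"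
    by (rule sum.swap)
  also have "\<dots> = 0"
  proof (rule sum.neutral, rule ballI)
    fix q :: "nat \<Rightarrow> 'n"
    \<comment> \<open>There are more indices than labels, so two indices share a label.\<close>
    have "card (q ` {1..m}) \<le> CARD('n)" by (intro card_mono) auto
    then have "\<not> inj_on q {1..m}" using m by (intro pigeonhole) simp
    then obtain a b where "a \<in> {1..m}" "b \<in> {1..m}" "a \<noteq> b" "q a = q b"
      unfolding inj_on_def by blast
    then show "(\<Sum>\<sigma>\<in>?P. of_int (sign \<sigma>) * H q (\<lambda>k. q (\<sigma> k))) = 0"
      by (intro sum_sign_permutations_repeated[of _ a b]) auto
  qed
  finally show ?thesis .
qed


section \<open>From traces to the Cayley-Hamilton expression\<close>

lemma mat_mult_entry: "(mat c ** M) $ p $ q = c * (M $ p $ q)" for M :: "'a::semiring_1^'n::finite^'n"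
  by (simp add: matrix_matrix_mult_def mat_def if_distrib[of "\<lambda>t. t * _"] cong: if_cong)

lemma foldr_mult_mat:
  "foldr (**) (map (\<lambda>w. mat (c w)) ws) (mat 1) =
    (mat (prod_list (map c ws)) :: 'a::semiring_1^'n::finite^'n)"
proof (induction ws)
  case (Cons w ws)
  then show ?case by (simp add: vec_eq_iff mat_mult_entry) (simp add: mat_def)
qed simp

lemma matrix_word_snoc:
  "matrix_word z (w @ [i]) = matrix_word z w ** z i"
  for z :: "'i \<Rightarrow> 'a::semiring_1^'n::finite^'n"
  by (induction w) (simp_all add: matrix_mul_assoc)

text \<open>
  The second factor is the matrix unit \<open>E\<^sub>s\<^sub>r\<close>. It turns an entry of a word into a trace, so that
  statements about \<open>\<Psi>\<close> reduce to statements about traces.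
\<close>

lemma trace_mult_matrix_unit:
  "trace (M ** (\<chi> p q. if p = s \<and> q = r then 1 else 0)) = M $ r $ s"
  for M :: "'a::semiring_1^'n::finite^'n"
proof -
  have "(\<Sum>k\<in>UNIV. M $ p $ k * (if k = s \<and> p = r then 1 else 0)) =
      (if p = r then M $ p $ s else 0)" for p
    by (cases "p = r") (simp_all add: if_distrib[of "\<lambda>t. _ * t"] cong: if_cong)
  then show ?thesis by (simp add: trace_def matrix_matrix_mult_def)
qed

theorem theorem5p1p1:
  fixes smul :: "complex \<Rightarrow> 'a::ring_1 \<Rightarrow> 'a"
    and grade :: "bit \<Rightarrow> 'a set"
    and e f :: nat
    and y x :: "nat \<Rightarrow> 'a^'n::finite^'n"
  assumes "supercommutative_superalgebra smul (*) 1 grade"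
    and "e + f = CARD('n) + 1"
    and "\<And>i. i \<in> {1..e} \<Longrightarrow> y i \<in> matrix_grade grade 0"
    and "\<And>j. j \<in> {1..f} \<Longrightarrow> x j \<in> matrix_grade grade 1"
  shows "trace_operations.CH (matrix_scale smul) (**) (mat 1) matrix_tr e f y x = 0
    \<and> trace_operations.T (matrix_scale smul) (**) (mat 1) matrix_tr e f y x = 0"
proof -
  interpret A: supercommutative_superalgebra smul "(*)" 1 grade by fact
  define m where "m = e + f"
  define z where "z = var e y x"
  have m: "m > CARD('n)" "m \<ge> 1" using assms(2) by (simp_all add: m_def)
  have scale: "matrix_scale smul (of_int (sign p)) M $ r $ s = of_int (sign p) * M $ r $ s"
    for p :: "nat \<Rightarrow> nat" and M :: "'a^'n^'n" and r s
    by (cases p rule: sign_cases) (simp_all add: matrix_scale_def)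
  have entry_grade: "z k $ p $ q \<in> grade (if e < k then 1 else 0)" if "k \<in> {1..m}" for k p q
  proof (cases "e < k")
    case True
    then have "k - e \<in> {1..f}" using that by (auto simp: m_def)
    then show ?thesis using assms(4)[of "k - e"] True by (simp add: z_def var_def matrix_grade_def)
  next
    case False
    then show ?thesis using that assms(3)[of k] by (simp add: z_def var_def matrix_grade_def)
  qed
  have scomm: "z k $ p $ q * z l $ p' $ q' =
      (if e < k \<and> e < l then - (z l $ p' $ q' * z k $ p $ q) else z l $ p' $ q' * z k $ p $ q)"
    if "k \<in> {1..m}" "l \<in> {1..m}" for k l p q p' q'
    using A.supercomm[OF entry_grade[OF that(1)] entry_grade[OF that(2)], of p q p' q']
    by (auto simp: koszul_sign_def split: if_splits)
  have "trace_operations.T (matrix_scale smul) (**) (mat 1) matrix_tr e f y x $ r $ s = 0" for r s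
  proof -
    let ?G = "\<lambda>\<sigma>. of_int (sign \<sigma>) *
      (of_int (sign (sorting_perm (filter (\<lambda>i. e < i) (concat (cycle_form m \<sigma>))))) *
        prod_list (map (\<lambda>w. trace (matrix_word z w)) (cycle_form m \<sigma>)))"
    have "trace_operations.T (matrix_scale smul) (**) (mat 1) matrix_tr e f y x $ r $ s =
      (\<Sum>\<sigma> | \<sigma> permutes {1..m}. if r = s then ?G \<sigma> else 0)"
      unfolding trace_operations.T_def trace_operations.Phi_def trace_operations.word_def
        trace_operations.list_prod_def Let_def matrix_tr_def foldr_mult_mat
        m_def[symmetric] z_def[symmetric] sum_component
      by (intro sum.cong refl) (simp add: scale fermionic_sign_def, simp add: mat_def)
    also have "\<dots> = (if r = s then \<Sum>\<sigma> | \<sigma> permutes {1..m}. ?G \<sigma> else 0)" by simp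
    also have "(\<Sum>\<sigma> | \<sigma> permutes {1..m}. ?G \<sigma>) = 0"
      using m(1) scomm is_cycle_form_exists by (intro signed_cycle_trace_sum_eq_0) auto
    finally show ?thesis by simp
  qed
  moreover have "trace_operations.CH (matrix_scale smul) (**) (mat 1) matrix_tr e f y x $ r $ s = 0"
    for r s
  proof -
    \<comment> \<open>The index \<open>m\<close> is assigned the matrix unit \<open>E\<^sub>s\<^sub>r\<close>; its entries are central, so \<open>m\<close> is
        treated as bosonic whatever the parity of the variable it replaces.\<close>
    define z' where "z' = z(m := \<chi> p q. if p = s \<and> q = r then 1 else 0)"
    let ?F = "\<lambda>i. e < i \<and> i \<noteq> m"
    let ?G = "\<lambda>\<sigma>. of_int (sign \<sigma>) *
      (of_int (sign (sorting_perm (filter ?F (concat (cycle_form_last m \<sigma>))))) *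
        prod_list (map (\<lambda>w. trace (matrix_word z' w)) (cycle_form_last m \<sigma>)))"
    have summand: "matrix_scale smul (of_int (sign \<sigma>))
        (trace_operations.Psi (matrix_scale smul) (**) (mat 1) matrix_tr e f y x \<sigma>) $ r $ s = ?G \<sigma>"
      if \<sigma>: "\<sigma> permutes {1..m}" for \<sigma>
    proof -
      define ws where "ws = cycle_form_last m \<sigma>"
      define vs where "vs = butlast ws"
      define u where "u = butlast (last ws)"
      have cf: "is_cycle_form m \<sigma> ws" "last (last ws) = m"
        using is_cycle_form_last_exists[OF \<sigma> m(2)] by (simp_all add: ws_def)
      then have "ws \<noteq> []" using m(2) by (auto simp: is_cycle_form_def)
      moreover from this have "last ws \<noteq> []"
        using cf(1) last_in_set[of ws] by (metis is_cycle_form_def)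
      ultimately have ws: "ws = vs @ [u @ [m]]"
        using cf(2) by (metis append_butlast_last_id u_def vs_def)
      have "distinct (concat (vs @ [u @ [m]]))" using cf(1) ws by (simp add: is_cycle_form_def)
      then have nm: "m \<notin> set (concat vs)" "m \<notin> set u" by auto
      have word: "matrix_word z' w = matrix_word z w" if "m \<notin> set w" for w
        using that by (intro arg_cong2[where f = "\<lambda>ms. foldr (**) ms"] map_cong) (auto simp: z'_def)
      have last_trace: "trace (matrix_word z' (u @ [m])) = matrix_word z u $ r $ s"
        unfolding matrix_word_snoc word[OF nm(2)] by (simp add: z'_def trace_mult_matrix_unit)
      have other_traces: "map (\<lambda>w. trace (matrix_word z' w)) vs = map (\<lambda>w. trace (matrix_word z w)) vs"
        using nm(1) by (intro map_cong refl) (auto simp: word)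
      have "prod_list (map (\<lambda>w. trace (matrix_word z' w)) ws) =
          prod_list (map (\<lambda>w. trace (matrix_word z' w)) vs) * trace (matrix_word z' (u @ [m]))"
        unfolding ws by simp
      then have traces: "prod_list (map (\<lambda>w. trace (matrix_word z' w)) ws) =
          prod_list (map (\<lambda>w. trace (matrix_word z w)) vs) * matrix_word z u $ r $ s"
        by (simp only: last_trace other_traces)
      have "filter ?F w = filter (\<lambda>i. e < i) w" if "m \<notin> set w" for w
        using that by (intro filter_cong) auto
      from this[OF nm(1)] this[OF nm(2)]
      have "filter ?F (concat ws) = filter (\<lambda>i. e < i) (concat vs @ u)"
        by (simp add: ws)
      then show ?thesis
        unfolding trace_operations.Psi_def trace_operations.word_def
          trace_operations.list_prod_def Let_def matrix_tr_def foldr_mult_mat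
          m_def[symmetric] z_def[symmetric] ws_def[symmetric] vs_def[symmetric] u_def[symmetric]
          traces
        by (simp add: scale fermionic_sign_def mat_mult_entry)
    qed
    have z'_scomm: "z' k $ p $ q * z' l $ p' $ q' =
      (if ?F k \<and> ?F l then - (z' l $ p' $ q' * z' k $ p $ q) else z' l $ p' $ q' * z' k $ p $ q)"
      if "k \<in> {1..m}" "l \<in> {1..m}" "k \<noteq> l" for k l p q p' q'
      using scomm[OF that(1,2), of p q p' q'] that(3) by (auto simp: z'_def)
    have "trace_operations.CH (matrix_scale smul) (**) (mat 1) matrix_tr e f y x $ r $ s =
      (\<Sum>\<sigma> | \<sigma> permutes {1..m}. ?G \<sigma>)"
      unfolding trace_operations.CH_def m_def[symmetric] sum_component
      by (intro sum.cong refl) (simp add: summand)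
    also have "\<dots> = 0"
      using m(1) z'_scomm is_cycle_form_last_exists[OF _ m(2)]
      by (intro signed_cycle_trace_sum_eq_0) blast+
    finally show ?thesis .
  qed
  ultimately show ?thesis by (simp add: vec_eq_iff)
qed

end
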